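(* Let $k,n\in\mathbb N$, $k>n$. Then $\mathcal F^{\mathbb R}_{k,n}$ is connected if and only if $\mathcal F^{\mathbb R}_{k,k-n}$ is connected.
   Context: $\mathbb N=\{1,2,\dots\}$. $\mathcal F^{\mathbb R}_{k,n}$ is the space of spherical tight frames of $k$ vectors in $\mathbb R^n$: all ordered lists $(f_1,\dots,f_k)$ of unit vectors in $\mathbb R^n$ for which there is $B>0$ with $\sum_{i=1}^k|\langle v,f_i\rangle|^2=B\|v\|^2$ for all $v\in\mathbb R^n$, with the relative topology from $(\mathbb R^n)^k$. *)

theory Defs
  imports "HOL-Analysis.Analysis"
begin

text \<open>
  A list of k vectors in n-dimensional real space is an element of \<^typ>\<open>real^'n^'k\<close>
  with n = CARD('n) and k = CARD('k); the i-th vector is f $ i.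
\<close>

definition spherical_tight_frames :: "(real^'n^'k) set" where
  "spherical_tight_frames =
     {f. (\<forall>i. norm (f $ i) = 1) \<and>
         (\<exists>B>0. \<forall>v. (\<Sum>i\<in>UNIV. \<bar>v \<bullet> f $ i\<bar>\<^sup>2) = B * (norm v)\<^sup>2)}"

end

theory Submission
  imports Defs
begin

text \<open>
  Write \<open>k\<close>, \<open>n\<close>, \<open>m = k - n\<close> for the cardinalities involved. A list of \<open>k\<close> vectors
  in n-space is a \<open>k \<times> n\<close> matrix, and it is a spherical tight frame exactly when its
  rows are unit vectors and its columns are orthogonal with common squared norm \<open>k/n\<close>.
  Hence, up to the factor \<open>sqrt (k/n)\<close>, the spherical tight frames in n-space are the
  \<open>n\<close>-column parts of those rotations of k-space in which every row of this part has squared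
  norm \<open>n/k\<close>; at least one column is left free because \<open>n < k\<close>, so the sign of the determinant
  is no obstruction. The rows of the complementary \<open>m\<close>-column part then have squared norm
  \<open>1 - n/k = m/k\<close>, so that part is, up to scaling, a spherical tight frame in m-space. The same
  set \<open>E\<close> of rotations thus maps onto both frame spaces.

  The set \<open>E\<close> is compact, and each fibre of either map consists of all rotations with
  some columns prescribed. Such a set of rotations is connected, and a continuous map from
  a compact space with connected fibres pulls connectedness of its image back to its domain.
  Therefore each frame space is connected if and only if \<open>E\<close> is.
  Working with rotations, rather than with all orthogonal matrices or with projections of
  k-space, is what makes the fibres connected without losing the orientation of the frames.

  Below, all \<open>k \<times> k\<close> matrices are transposed, so that the orthonormal vectors
  extracted from a rotation are its rows. The main lemmas are
  \<open>connected_of_compact_monotone\<close>, \<open>connected_rotations_with_fixed_rows\<close>,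
  \<open>frame_rotations_Compl\<close> and \<open>connected_frames_iff_connected_frame_rotations\<close>.
\<close>

section \<open>Continuous maps with connected fibres\<close>

lemma connected_of_compact_monotone:
  fixes f :: "'a::t2_space \<Rightarrow> 'b::t2_space"
  assumes "compact S" "continuous_on S f" "connected (f ` S)"
    and fibres: "\<And>y. y \<in> f ` S \<Longrightarrow> connected {x \<in> S. f x = y}"
  shows "connected S"
proof -
  have "connected (S \<inter> f -` (f ` S))"
  proof (rule connected_closed_monotone_preimage[OF assms(2) refl])
    show "closedin (top_of_set (f ` S)) (f ` C)" if "closedin (top_of_set S) C" for C
      using Abstract_Topology_2.continuous_imp_closed_map[OF that assms(2) refl assms(1)] .
    show "connected (S \<inter> f -` {y})" if "y \<in> f ` S" for y
      using fibres[OF that] by (simp add: Int_def vimage_def)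
  qed (rule assms(3), rule order_refl)
  moreover have "S \<inter> f -` (f ` S) = S" by blast
  ultimately show ?thesis by simp
qed

section \<open>Completing orthonormal rows to a rotation\<close>

lemma orthogonal_matrix_iff_inner_rows:
  fixes U :: "real^'k^'k"
  shows "orthogonal_matrix U \<longleftrightarrow> (\<forall>i j. U$i \<bullet> U$j = (if i = j then 1 else 0))"
  by (auto simp: orthogonal_matrix_orthonormal_rows row_def orthogonal_def norm_eq_1)

lemma det_scale_row:
  fixes U :: "real^'k^'k"
  shows "det (\<chi> i. if i = c then s *\<^sub>R U$i else U$i) = s * det U"
  using det_row_mul[of c s "\<lambda>i. U$i" "\<lambda>i. U$i", unfolded scalar_mult_eq_scaleR]
  by simp

text \<open>
  The rows are prescribed one at a time: a reflection exchanging the current row with the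
  wanted one fixes all rows prescribed earlier, since both are orthogonal to these.
\<close>

lemma orthogonal_matrix_extending:
  fixes w :: "'k::finite \<Rightarrow> real^'k"
  assumes "\<And>i j. i \<in> T \<Longrightarrow> j \<in> T \<Longrightarrow> w i \<bullet> w j = (if i = j then 1 else 0)"
  shows "\<exists>U::real^'k^'k. orthogonal_matrix U \<and> (\<forall>j\<in>T. U$j = w j)"
proof -
  have "finite T" by simp
  then show ?thesis using assms
  proof (induction T rule: finite_induct)
    case empty
    show ?case using orthogonal_matrix_id by blast
  next
    case (insert c T)
    then obtain U :: "real^'k^'k" where U: "orthogonal_matrix U" "\<And>j. j \<in> T \<Longrightarrow> U$j = w j"
      by (metis insertI2)
    have UU: "U$i \<bullet> U$j = (if i = j then 1 else 0)" for i j
      using U(1) orthogonal_matrix_iff_inner_rows by blast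
    show ?case
    proof (cases "U$c = w c")
      case True
      then show ?thesis using U by auto
    next
      case False
      \<comment> \<open>\<open>h\<close> is the reflection in the hyperplane orthogonal to \<open>v\<close>.\<close>
      define v where "v = U$c - w c"
      define h where "h = (\<lambda>x. x - (2 * (x \<bullet> v) / (v \<bullet> v)) *\<^sub>R v)"
      have v: "v \<bullet> v \<noteq> 0" using False by (simp add: v_def)
      have hh: "h x \<bullet> h y = x \<bullet> y" for x y
        using v by (simp add: h_def inner_diff_left inner_diff_right inner_commute[of v x] inner_commute[of v y])
      have wc: "w c \<bullet> w c = 1" "U$c \<bullet> U$c = 1"
        using insert.prems[of c c] UU[of c c] by auto
      have "2 * (U$c \<bullet> v) = v \<bullet> v"
        using wc by (simp add: v_def inner_diff_left inner_diff_right inner_commute[of "w c" "U$c"])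
      then have hc: "h (U$c) = w c" 
        using v by (simp add: h_def v_def)
      have hT: "h (U$j) = w j" if "j \<in> T" for j
      proof -
        have "j \<noteq> c" using that insert.hyps by auto
        then have "U$j \<bullet> v = 0"
          using UU[of j c] insert.prems[of j c] that U(2)[OF that]
          by (simp add: v_def inner_diff_right)
        then show ?thesis using U(2)[OF that] by (simp add: h_def)
      qed
      have "orthogonal_matrix (\<chi> i. h (U$i))"
        by (simp add: orthogonal_matrix_iff_inner_rows hh UU)
      then show ?thesis using hc hT by (intro exI[of _ "\<chi> i. h (U$i)"]) auto
    qed
  qed
qed

lemma rotation_matrix_extending:
  fixes w :: "'k::finite \<Rightarrow> real^'k"
  assumes "\<And>i j. i \<in> T \<Longrightarrow> j \<in> T \<Longrightarrow> w i \<bullet> w j = (if i = j then 1 else 0)"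
    and "T \<noteq> UNIV"
  obtains U :: "real^'k^'k" where "rotation_matrix U" "\<And>j. j \<in> T \<Longrightarrow> U$j = w j"
proof -
  obtain U :: "real^'k^'k" where U: "orthogonal_matrix U" "\<And>j. j \<in> T \<Longrightarrow> U$j = w j"
    using orthogonal_matrix_extending[OF assms(1)] by blast
  obtain c where c: "c \<notin> T" using assms(2) by blast
  \<comment> \<open>The determinant is 1 or -1, so scaling a free row by it makes it 1.\<close>
  define W where "W = (\<chi> i. if i = c then det U *\<^sub>R U$i else U$i)"
  have d: "det U * det U = 1" using det_orthogonal_matrix[OF U(1)] by auto
  have "orthogonal_matrix W"
    using U(1) d by (auto simp: orthogonal_matrix_iff_inner_rows W_def mult.assoc[symmetric])
  moreover have "det W = 1" using d by (simp add: W_def det_scale_row)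
  ultimately show ?thesis
    using c U(2) by (intro that[of W]) (auto simp: rotation_matrix_def W_def)
qed

section \<open>Rotations with prescribed rows\<close>

lemma compact_rotation_matrices: "compact {U :: real^'k^'k. rotation_matrix U}"
proof (rule compact_eq_bounded_closed[THEN iffD2], rule conjI)
  have "norm U \<le> real CARD('k)" if "orthogonal_matrix U" for U :: "real^'k^'k"
  proof -
    have "norm (U$i) = 1" for i
      using that by (simp add: orthogonal_matrix_iff_inner_rows norm_eq_1)
    then show ?thesis
      using L2_set_le_sum[of UNIV "\<lambda>i. norm (U$i)"] by (simp add: norm_vec_def)
  qed
  then show "bounded {U :: real^'k^'k. rotation_matrix U}"
    by (auto simp: rotation_matrix_def intro!: boundedI)
  show "closed {U :: real^'k^'k. rotation_matrix U}"
    unfolding rotation_matrix_def orthogonal_matrix_iff_inner_rows det_def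
    by (intro closed_Collect_conj closed_Collect_all closed_Collect_eq continuous_intros)
qed

lemma rotation_matrix_determined_by_rows:
  fixes U V :: "real^'k^'k"
  assumes U: "rotation_matrix U" and V: "rotation_matrix V" 
    and eq: "\<And>j. j \<noteq> c \<Longrightarrow> U$j = V$j"
  shows "U = V"
proof -
  \<comment> \<open>Row \<open>c\<close> of \<open>U\<close> is orthogonal to the other rows of \<open>V\<close>, hence is \<open>s\<close> times row \<open>c\<close> of \<open>V\<close>.\<close>
  define s where "s = V$c \<bullet> U$c"
  have "V *v (U$c) = s *\<^sub>R axis c 1"
  proof -
    have "V$i \<bullet> U$c = 0" if "i \<noteq> c" for i
      using U that eq[OF that] by (metis orthogonal_matrix_iff_inner_rows rotation_matrix_def)
    then show ?thesis by (auto simp: vec_eq_iff matrix_vector_mul_component s_def axis_def)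
  qed
  then have "transpose V *v (V *v (U$c)) = s *\<^sub>R (V$c)"
    by (simp only: matrix_vector_mult_scaleR matrix_vector_mult_basis)
       (simp add: column_def transpose_def)
  then have Uc: "U$c = s *\<^sub>R V$c"
    using V by (simp add: matrix_vector_mul_assoc rotation_matrix_def orthogonal_matrix)
  then have *: "U = (\<chi> i. if i = c then s *\<^sub>R V$i else V$i)"
    using eq by (simp add: vec_eq_iff)
  have "s = 1"
    using arg_cong[OF *, of det] U V by (simp add: det_scale_row rotation_matrix_def)
  then show ?thesis using * by (simp add: vec_eq_iff)
qed

text \<open>
  The vectors \<open>a\<close> and \<open>b\<close> witness that the orthogonal complement of \<open>X\<close> has dimension
  at least two.
\<close>

lemma connected_unit_sphere_orthogonal_complement:
  fixes a b :: "'a::euclidean_space"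
  assumes "norm a = 1" "norm b = 1" "a \<bullet> b = 0" 
    and "\<And>x. x \<in> X \<Longrightarrow> x \<bullet> a = 0 \<and> x \<bullet> b = 0"
  shows "connected {y. norm y = 1 \<and> (\<forall>x\<in>X. x \<bullet> y = 0)}" (is "connected ?S")
proof -
  define W where "W = {y. \<forall>x\<in>X. x \<bullet> y = 0}"
  have "convex W" by (auto simp: W_def convex_def inner_add_right)
  moreover have "\<not> collinear W"
  proof
    assume "collinear W"
    moreover have "{0,a,b} \<subseteq> W" using assms by (auto simp: W_def)
    ultimately have "collinear {0,a,b}" using collinear_subset by blast
    then show False using assms by (auto simp: collinear_lemma)
  qed
  \<comment> \<open>The sphere is the radial image of the complement with the origin removed.\<close>
  ultimately have "connected (W - {0})"
    by (intro connected_convex_diff_countable) auto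
  moreover have "continuous_on (W - {0}) sgn"
    by (intro continuous_intros) auto
  ultimately have "connected (sgn ` (W - {0}))" by (rule connected_continuous_image[rotated])
  also have "sgn ` (W - {0}) = ?S"
  proof
    show "sgn ` (W - {0}) \<subseteq> ?S" by (auto simp: W_def norm_sgn) (simp add: sgn_div_norm)
    show "?S \<subseteq> sgn ` (W - {0})"
    proof
      fix y assume "y \<in> ?S"
      then show "y \<in> sgn ` (W - {0})"
        by (intro image_eqI[of _ _ y]) (auto simp: W_def sgn_div_norm)
    qed
  qed
  finally show ?thesis .
qed

text \<open>
  Induction on the number of free rows. With at most one free row the set is a single point.
  Otherwise, evaluation at a free row \<open>c\<close> maps the set onto the unit sphere of the orthogonal
  complement of the prescribed rows, which has dimension at least two; the fibres are sets
  of the same kind in which row \<open>c\<close> is prescribed too. For \<open>T = {}\<close> this says that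
  the rotation group is connected.
\<close>

lemma connected_rotations_with_fixed_rows:
  fixes V :: "real^'k^'k"
  assumes "rotation_matrix V"
  shows "connected {U. rotation_matrix U \<and> (\<forall>j\<in>T. U$j = V$j)}"
  using assms
proof (induction "card (-T)" arbitrary: T V rule: less_induct)
  case less
  let ?S = "{U. rotation_matrix U \<and> (\<forall>j\<in>T. U$j = V$j)}"
  have V: "V$i \<bullet> V$j = (if i = j then 1 else 0)" for i j
    using less.prems by (simp add: rotation_matrix_def orthogonal_matrix_iff_inner_rows)
  show ?case
  proof (cases "\<exists>c. -T \<subseteq> {c}")
    case True
    then obtain c where "-T \<subseteq> {c}" by blast
    then have "?S \<subseteq> {V}"
      using rotation_matrix_determined_by_rows[OF _ less.prems, of _ c] by blast
    then consider "?S = {}" | "?S = {V}" by (meson subset_singletonD)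
    then show ?thesis
    proof cases
      case 1
      show ?thesis unfolding 1 by (rule connected_empty)
    next
      case 2
      show ?thesis unfolding 2 by (rule connected_sing)
    qed
  next
    case False
    then obtain c d where cd: "c \<notin> T" "d \<notin> T" "c \<noteq> d" by blast
    let ?N = "{y. norm y = 1 \<and> (\<forall>x\<in>(\<lambda>j. V$j) ` T. x \<bullet> y = 0)}"
    show ?thesis
    proof (rule connected_of_compact_monotone[where f = "\<lambda>U. U$c"])
      have "?S = {U. rotation_matrix U} \<inter> {U. \<forall>j\<in>T. U$j = V$j}" by auto
      moreover have "closed {U. \<forall>j\<in>T. U$j = V$j}"
        unfolding Ball_def
        by (intro closed_Collect_all closed_Collect_imp closed_Collect_eq open_Collect_const continuous_intros)
      ultimately show "compact ?S" 
        using compact_Int_closed[OF compact_rotation_matrices] by simp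
      show "continuous_on ?S (\<lambda>U. U$c)" by (intro continuous_intros)
      have "(\<lambda>U. U$c) ` ?S = ?N"
      proof (intro equalityI subsetI)
        fix y assume "y \<in> (\<lambda>U. U$c) ` ?S"
        then obtain U where U: "rotation_matrix U" "\<forall>j\<in>T. U$j = V$j" "y = U$c" by blast
        then have "U$i \<bullet> U$j = (if i = j then 1 else 0)" for i j
          by (simp add: rotation_matrix_def orthogonal_matrix_iff_inner_rows)
        then have "norm y = 1" "\<And>j. j \<in> T \<Longrightarrow> V$j \<bullet> y = 0"
          using U(2) cd(1) by (auto simp: U(3) norm_eq_1 simp flip: U(2)[rule_format])
        then show "y \<in> ?N" by blast
      next
        fix y assume y: "y \<in> ?N"
        obtain U :: "real^'k^'k" where U: "rotation_matrix U" 
          "\<And>j. j \<in> insert c T \<Longrightarrow> U$j = (if j = c then y else V$j)"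
        proof (rule rotation_matrix_extending[of "insert c T" "\<lambda>j. if j = c then y else V$j"])
          show "insert c T \<noteq> UNIV" using cd by auto
        qed (use y cd V in \<open>auto simp: norm_eq_1 inner_commute\<close>)
        show "y \<in> (\<lambda>U. U$c) ` ?S"
          using U(1) U(2) cd by (intro image_eqI[of _ _ U]) auto
      qed
      moreover have "connected ?N"
        by (rule connected_unit_sphere_orthogonal_complement[of "V$c" "V$d"])
           (use V cd in \<open>auto simp: norm_eq_1\<close>)
      ultimately show "connected ((\<lambda>U. U$c) ` ?S)" by simp
    next
      fix y assume "y \<in> (\<lambda>U. U$c) ` ?S"
      then obtain V' where V': "rotation_matrix V'" "\<forall>j\<in>T. V'$j = V$j" "y = V'$c" by blast
      have "{U \<in> ?S. U$c = y} = {U. rotation_matrix U \<and> (\<forall>j\<in>insert c T. U$j = V'$j)}"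
        using V' by auto
      moreover have "card (- insert c T) < card (- T)" 
        using cd by (intro psubset_card_mono) auto
      ultimately show "connected {U \<in> ?S. U$c = y}"
        using less.hyps[OF _ V'(1), of "insert c T"] by simp
    qed
  qed
qed

section \<open>Tight frames as parts of rotations\<close>

lemma tight_frame_iff_columns:
  fixes f :: "real^'n^'k"
  shows "f \<in> spherical_tight_frames \<longleftrightarrow>
    (\<forall>i. norm (f$i) = 1) \<and>
    (\<forall>j j'. (\<Sum>i\<in>UNIV. f$i$j * f$i$j') = (if j = j' then real CARD('k) / real CARD('n) else 0))"
    (is "_ \<longleftrightarrow> ?N \<and> ?C")
proof
  assume f: "f \<in> spherical_tight_frames"
  then have N: ?N by (simp add: spherical_tight_frames_def)
  obtain B where B: "(\<Sum>i\<in>UNIV. (v \<bullet> f$i)\<^sup>2) = B * (v \<bullet> v)" for v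
    using f by (auto simp: spherical_tight_frames_def power2_norm_eq_inner)
  \<comment> \<open>Polarization of the tight frame identity shows that the columns are orthogonal.\<close>
  have polar: "(\<Sum>i\<in>UNIV. (x \<bullet> f$i) * (y \<bullet> f$i)) = B * (x \<bullet> y)" for x y
    using B[of "x + y"] B[of x] B[of y]
    by (simp add: inner_add_left inner_add_right power2_sum sum.distrib algebra_simps
        inner_commute[of y x] flip: sum_distrib_left)
  have C: "(\<Sum>i\<in>UNIV. f$i$j * f$i$j') = (if j = j' then B else 0)" for j j'
  proof -
    have "(\<Sum>i\<in>UNIV. f$i$j * f$i$j') = B * axis j' 1 $ j"
      using polar[of "axis j 1" "axis j' 1"] by (simp add: inner_axis')
    then show ?thesis by (simp add: axis_def)
  qed
  \<comment> \<open>Summing the squares of all entries by rows and by columns determines \<open>B\<close>.\<close>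
  have "real CARD('k) = (\<Sum>i\<in>UNIV. f$i \<bullet> f$i)"
    using N by (simp add: norm_eq_1)
  also have "\<dots> = (\<Sum>i\<in>UNIV. \<Sum>j\<in>UNIV. f$i$j * f$i$j)"
    by (simp add: inner_vec_def)
  also have "\<dots> = (\<Sum>j\<in>UNIV. \<Sum>i\<in>UNIV. f$i$j * f$i$j)"
    by (rule sum.swap)
  also have "\<dots> = real CARD('n) * B" by (simp add: C)
  finally have "B = real CARD('k) / real CARD('n)" by (simp add: field_simps)
  with N C show "?N \<and> ?C" by simp
next
  assume f: "?N \<and> ?C"
  then have C: "(\<Sum>i\<in>UNIV. f$i$j * f$i$j') = (if j = j' then real CARD('k) / real CARD('n) else 0)"
    for j j' by blast
  have "(\<Sum>i\<in>UNIV. \<bar>v \<bullet> f$i\<bar>\<^sup>2) = real CARD('k) / real CARD('n) * (norm v)\<^sup>2" for v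
  proof -
    have "(\<Sum>i\<in>UNIV. \<bar>v \<bullet> f$i\<bar>\<^sup>2) = (\<Sum>i\<in>UNIV. \<Sum>j\<in>UNIV. \<Sum>j'\<in>UNIV. v$j * v$j' * (f$i$j * f$i$j'))"
      by (simp add: inner_vec_def power2_eq_square sum_product mult_ac)
    also have "\<dots> = (\<Sum>j\<in>UNIV. \<Sum>i\<in>UNIV. \<Sum>j'\<in>UNIV. v$j * v$j' * (f$i$j * f$i$j'))"
      by (rule sum.swap)
    also have "\<dots> = (\<Sum>j\<in>UNIV. \<Sum>j'\<in>UNIV. v$j * v$j' * (\<Sum>i\<in>UNIV. f$i$j * f$i$j'))"
      unfolding sum_distrib_left by (intro sum.cong refl sum.swap)
    also have "\<dots> = (\<Sum>j\<in>UNIV. v$j * v$j * (real CARD('k) / real CARD('n)))"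
      by (simp add: C if_distrib cong: if_cong)
    also have "\<dots> = real CARD('k) / real CARD('n) * (norm v)\<^sup>2"
      by (simp only: power2_norm_eq_inner inner_vec_def inner_real_def sum_distrib_left mult.commute)
    finally show ?thesis .
  qed
  then show "f \<in> spherical_tight_frames"
    using f by (auto simp: spherical_tight_frames_def intro!: exI[of _ "real CARD('k) / real CARD('n)"])
qed

text \<open>
  For nonempty \<open>A\<close>: the rotations whose rows with index in \<open>A\<close> form, up to scaling, the columns of a spherical
  tight frame of \<open>CARD('k)\<close> vectors in dimension \<open>card A\<close>.
\<close>

definition frame_rotations :: "'k set \<Rightarrow> (real^'k^'k) set" where
  "frame_rotations A =
     {U. rotation_matrix U \<and> (\<forall>i. (\<Sum>j\<in>A. (U$j$i)\<^sup>2) = real (card A) / real CARD('k))}"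

lemma compact_frame_rotations: "compact (frame_rotations A :: (real^'k^'k) set)"
proof -
  have "closed {U :: real^'k^'k. \<forall>i. (\<Sum>j\<in>A. (U$j$i)\<^sup>2) = real (card A) / real CARD('k)}"
    by (intro closed_Collect_all closed_Collect_eq continuous_intros)
  from compact_Int_closed[OF compact_rotation_matrices this] show ?thesis
    by (simp add: frame_rotations_def Int_def)
qed

lemma frame_rotations_Compl: 
  "frame_rotations (- A) = (frame_rotations A :: (real^'k^'k) set)"
proof -
  have "(\<Sum>j\<in>-A. (U$j$i)\<^sup>2) = real (card (-A)) / real CARD('k)
    \<longleftrightarrow> (\<Sum>j\<in>A. (U$j$i)\<^sup>2) = real (card A) / real CARD('k)" 
    if "rotation_matrix U" for U :: "real^'k^'k" and i
  proof -
    have "column i U \<bullet> column i U = 1"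
      using that by (simp add: rotation_matrix_def orthogonal_matrix_orthonormal_columns norm_eq_1)
    then have "(\<Sum>j\<in>UNIV. (U$j$i)\<^sup>2) = 1"
      by (simp add: column_def inner_vec_def power2_eq_square)
    moreover have "(\<Sum>j\<in>UNIV. (U$j$i)\<^sup>2) = (\<Sum>j\<in>A. (U$j$i)\<^sup>2) + (\<Sum>j\<in>-A. (U$j$i)\<^sup>2)"
      by (subst sum.union_disjoint[symmetric]) auto
    moreover have "real CARD('k) = real (card A) + real (card (-A))"
      by (subst of_nat_add[symmetric], subst card_Un_disjoint[symmetric]) auto
    moreover have "real (card A) / real CARD('k) + real (card (-A)) / real CARD('k) = 1"
      unfolding add_divide_distrib[symmetric] calculation(3)[symmetric] by simp
    ultimately show ?thesis by linarith
  qed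
  then show ?thesis by (auto simp: frame_rotations_def)
qed

text \<open>
  Scaling the rows with index in \<open>range a\<close> by \<open>sqrt (k/n)\<close> and reading them as columns is a
  continuous map onto the spherical tight frames, and its fibres are sets of rotations with these
  rows prescribed. The condition \<open>range a \<noteq> UNIV\<close> leaves a row to adjust the determinant.
\<close>

lemma connected_frames_iff_connected_frame_rotations:
  fixes a :: "'n::finite \<Rightarrow> 'k::finite"
  assumes "inj a" "range a \<noteq> UNIV"
  shows "connected (spherical_tight_frames :: (real^'n^'k) set) \<longleftrightarrow>
    connected (frame_rotations (range a))"
proof -
  let ?n = "real CARD('n)" and ?k = "real CARD('k)" 
  define p :: "real^'k^'k \<Rightarrow> real^'n^'k" where "p = (\<lambda>U. \<chi> i j. sqrt (?k / ?n) * U$(a j)$i)"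
  have card: "card (range a) = CARD('n)" using assms(1) by (simp add: card_image)
  have pos: "?k / ?n > 0" by simp
  have sqrt: "sqrt (?k / ?n) * sqrt (?k / ?n) = ?k / ?n" by simp
  have norm_row: "(norm (p U $ i))\<^sup>2 = ?k / ?n * (\<Sum>j\<in>range a. (U$j$i)\<^sup>2)" for U i
  proof -
    have "(norm (p U $ i))\<^sup>2 = (\<Sum>j\<in>UNIV. (sqrt (?k / ?n) * U$(a j)$i)\<^sup>2)"
      by (simp only: power2_norm_eq_inner inner_vec_def p_def vec_lambda_beta) (simp add: power2_eq_square)
    also have "\<dots> = ?k / ?n * (\<Sum>j\<in>UNIV. (U$(a j)$i)\<^sup>2)"
      by (simp add: power_mult_distrib sum_distrib_left)
    finally show ?thesis using assms(1) by (simp add: sum.reindex)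
  qed
  have columns: "(\<Sum>i\<in>UNIV. p U$i$j * p U$i$j') = ?k / ?n * (U$(a j) \<bullet> U$(a j'))" for U j j'
  proof -
    have "p U$i$j * p U$i$j' = ?k / ?n * (U$(a j)$i * U$(a j')$i)" for i
      using sqrt by (simp only: p_def vec_lambda_beta mult_ac)
    then show ?thesis by (simp only: inner_vec_def sum_distrib_left inner_real_def)
  qed
  have frame_iff: "p U \<in> spherical_tight_frames \<longleftrightarrow> U \<in> frame_rotations (range a)" 
    if U: "rotation_matrix U" for U
  proof -
    have "norm (p U $ i) = 1 \<longleftrightarrow> (\<Sum>j\<in>range a. (U$j$i)\<^sup>2) = ?n / ?k" for i
    proof -
      have "norm (p U $ i) = 1 \<longleftrightarrow> (norm (p U $ i))\<^sup>2 = 1" 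
        by (simp add: abs_square_eq_1)
      then show ?thesis unfolding norm_row by (auto simp: field_simps)
    qed
    moreover have "(\<Sum>i\<in>UNIV. p U$i$j * p U$i$j') = (if j = j' then ?k / ?n else 0)" for j j'
      using U assms(1) by (simp add: columns rotation_matrix_def orthogonal_matrix_iff_inner_rows inj_eq)
    ultimately show ?thesis 
      using U by (simp add: tight_frame_iff_columns frame_rotations_def card)
  qed
  have p_eq: "p U = p V \<longleftrightarrow> (\<forall>j\<in>range a. U$j = V$j)" for U V
    using pos by (auto simp: p_def vec_eq_iff)
  have image: "p ` frame_rotations (range a) = spherical_tight_frames"
  proof (intro equalityI subsetI)
    fix f assume "f \<in> p ` frame_rotations (range a)"
    then show "f \<in> spherical_tight_frames"
      using frame_iff by (auto simp: frame_rotations_def)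
  next
    fix f :: "real^'n^'k" assume f: "f \<in> spherical_tight_frames"
    \<comment> \<open>Only the values of \<open>w\<close> on \<open>range a\<close> matter: these are the rescaled columns of \<open>f\<close>.\<close>
    define w :: "'k \<Rightarrow> real^'k" where "w = (\<lambda>l. (1 / sqrt (?k / ?n)) *\<^sub>R column (inv a l) f)"
    have w: "w (a j) \<bullet> w (a j') = (if j = j' then 1 else 0)" for j j'
    proof -
      have "w (a j) \<bullet> w (a j') = (\<Sum>i\<in>UNIV. f$i$j * f$i$j') / (?k / ?n)"
        using assms(1) by (simp add: w_def column_def inner_vec_def sum_distrib_right sum_divide_distrib)
      then show ?thesis using f by (simp add: tight_frame_iff_columns)
    qed
    obtain U :: "real^'k^'k" where U: "rotation_matrix U" "\<And>l. l \<in> range a \<Longrightarrow> U$l = w l"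
      by (rule rotation_matrix_extending[of "range a" w])
         (use w assms in \<open>auto simp: inj_eq\<close>)
    have "p U = f"
      using U(2) assms(1) by (simp add: vec_eq_iff p_def w_def column_def)
    then show "f \<in> p ` frame_rotations (range a)"
      using frame_iff[OF U(1)] f by blast
  qed
  have cont: "continuous_on S p" for S
    unfolding p_def by (intro continuous_intros)
  show ?thesis
  proof
    assume "connected (spherical_tight_frames :: (real^'n^'k) set)"
    then have "connected (p ` frame_rotations (range a))" by (simp add: image)
    then show "connected (frame_rotations (range a))"
    proof (rule connected_of_compact_monotone[OF compact_frame_rotations cont])
      fix y assume "y \<in> p ` frame_rotations (range a)"
      then obtain V where V: "V \<in> frame_rotations (range a)" "y = p V" by blast
      then have rV: "rotation_matrix V" by (simp add: frame_rotations_def)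
      \<comment> \<open>The condition on squared norms involves prescribed rows only, so it holds on the whole fibre.\<close>
      have "{U \<in> frame_rotations (range a). p U = y} = 
        {U. rotation_matrix U \<and> (\<forall>j\<in>range a. U$j = V$j)}"
      proof (intro equalityI subsetI)
        fix U assume "U \<in> {U. rotation_matrix U \<and> (\<forall>j\<in>range a. U$j = V$j)}"
        then have "rotation_matrix U" "p U = p V" by (auto simp: p_eq)
        then show "U \<in> {U \<in> frame_rotations (range a). p U = y}"
          using frame_iff[of U] frame_iff[OF rV] V by simp
      qed (use V in \<open>auto simp: frame_rotations_def p_eq\<close>)
      then show "connected {U \<in> frame_rotations (range a). p U = y}"
        using connected_rotations_with_fixed_rows[OF rV, of "range a"] by (simp only:)
    qed
  next
    assume "connected (frame_rotations (range a))"
    then show "connected (spherical_tight_frames :: (real^'n^'k) set)"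
      using connected_continuous_image[OF cont] image by metis
  qed
qed

theorem corollary7p3:
  assumes "CARD('n::finite) < CARD('k::finite)"
    and "CARD('m::finite) = CARD('k) - CARD('n)"
  shows "connected (spherical_tight_frames :: (real^'n^'k) set) \<longleftrightarrow>
         connected (spherical_tight_frames :: (real^'m^'k) set)"
proof -
  \<comment> \<open>The index set of the rows is split into a part of size \<open>n\<close> and its complement of size \<open>m\<close>.\<close>
  obtain a :: "'n \<Rightarrow> 'k" where a: "inj a"
    using card_le_inj[of "UNIV :: 'n set" "UNIV :: 'k set"] assms(1) by auto
  then have "card (range a) = CARD('n)" by (simp add: card_image)
  then have "card (- range a) = CARD('m)" 
    using assms(2) by (simp add: Compl_eq_Diff_UNIV card_Diff_subset)
  then obtain b :: "'m \<Rightarrow> 'k" where b: "bij_betw b UNIV (- range a)"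
    using finite_same_card_bij[of "UNIV :: 'm set" "- range a"] by auto
  then have b': "inj b" "range b = - range a" by (auto simp: bij_betw_def)
  have "range a \<noteq> UNIV" using \<open>card (range a) = CARD('n)\<close> assms(1) by auto
  then show ?thesis
    using connected_frames_iff_connected_frame_rotations[OF a]
      connected_frames_iff_connected_frame_rotations[OF b'(1)] b'(2)
    by (auto simp: frame_rotations_Compl)
qed

end
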